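(* Let $n,k\in\mathbb{N}$ and $T\in\operatorname{YT}(n)$. The multiset $\operatorname{mM}_k(T)$ determines $T$ (i.e. if $S\in\operatorname{YT}(n)$ and $\operatorname{mM}_k(S)=\operatorname{mM}_k(T)$ then $S=T$) whenever \[2\binom{n-k^2-2k}{k}>\binom{n}{k}.\] This inequality is satisfied in particular when \[n>k^2+3k-1+\frac{k^2+2k}{2^{1/k}-1},\] and hence in particular whenever \[n>\frac{k^3+2k^2}{\ln 2}+\frac{k^2}{2}+2k-1+\frac{\ln 2}{12}(k+2).\]
   Context: $\mathbb{N}=\{1,2,\dots\}$. A (standard Young) tableau of shape $\lambda$ (a partition of $n$) is a filling of the Young diagram of $\lambda$ by distinct elements of $[1,n]$ increasing strictly along rows and down columns; $\operatorname{YT}(n)$ is the set of such tableaux with entries exactly $[1,n]$. Deletion by jeu de taquin: for $T\in\operatorname{YT}(n)$ and an entry $m$, delete the cell containing $m$; repeatedly, if there is a cell directly to the right of or directly below the empty space, slide the one with the smaller entry into it; stop when neither exists; then subtract 1 from every entry larger than $m$, giving $T-m\in\operatorname{YT}(n-1)$. A $k$-minor of $T$ is a tableau obtained by $k$ successive such deletions. $\operatorname{mM}_k(T)$ is the multiset of all $k$-minors of $T$, one for each of the $n(n-1)\cdots(n-k+1)$ sequences of successive choices of cells to delete (counted with multiplicity). *)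

theory Defs
  imports Complex_Main "HOL-Library.Multiset"
begin

definition is_partition :: "nat list \<Rightarrow> nat \<Rightarrow> bool" where
  "is_partition \<mu> n \<longleftrightarrow> sorted_wrt (\<ge>) \<mu> \<and> 0 \<notin> set \<mu> \<and> sum_list \<mu> = n"

text \<open>Cells are pairs (row, column), both counted from 0, with rows numbered downwards.\<close>

type_synonym cell = "nat \<times> nat"

definition young_diagram :: "nat list \<Rightarrow> cell set" where
  "young_diagram \<mu> = {(i, j). i < length \<mu> \<and> j < \<mu> ! i}"

text \<open>A filling is a partial map from cells to entries, so its shape is recorded by its domain
  and equality of fillings includes equality of shapes.\<close>

type_synonym filling = "cell \<rightharpoonup> nat"

definition tableau_of_shape :: "nat list \<Rightarrow> filling \<Rightarrow> bool" where
  "tableau_of_shape \<mu> T \<longleftrightarrow>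
     dom T = young_diagram \<mu> \<and> inj_on T (dom T) \<and>
     (\<forall>i j j'. j < j' \<longrightarrow> (i, j) \<in> dom T \<longrightarrow> (i, j') \<in> dom T \<longrightarrow> the (T (i, j)) < the (T (i, j'))) \<and>
     (\<forall>i i' j. i < i' \<longrightarrow> (i, j) \<in> dom T \<longrightarrow> (i', j) \<in> dom T \<longrightarrow> the (T (i, j)) < the (T (i', j)))"

definition YT :: "nat \<Rightarrow> filling set" where
  "YT n = {T. ran T = {1..n} \<and> (\<exists>\<mu>. is_partition \<mu> n \<and> tableau_of_shape \<mu> T)}"

definition right_of :: "cell \<Rightarrow> cell" where
  "right_of c = (fst c, Suc (snd c))"

definition below :: "cell \<Rightarrow> cell" where
  "below c = (Suc (fst c), snd c)"

definition move_entry :: "filling \<Rightarrow> cell \<Rightarrow> cell \<Rightarrow> filling" where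
  "move_entry T d c = T(c := T d, d := None)"

text \<open>\<open>slide T c\<close> plays jeu de taquin from the empty cell \<open>c\<close>. The finiteness guard, always
  satisfied for tableaux, only serves to make the recursion total.\<close>

function slide :: "filling \<Rightarrow> cell \<Rightarrow> filling" where
  "slide T c =
     (if infinite (dom T) then T else
      (case (T (right_of c), T (below c)) of
         (None, None) \<Rightarrow> T
       | (Some a, None) \<Rightarrow> slide (move_entry T (right_of c) c) (right_of c)
       | (None, Some b) \<Rightarrow> slide (move_entry T (below c) c) (below c)
       | (Some a, Some b) \<Rightarrow>
           if a < b then slide (move_entry T (right_of c) c) (right_of c)
           else slide (move_entry T (below c) c) (below c)))"
  by pat_completeness auto

lemma slide_measure_decreases:
  assumes "finite (dom T)" "d = right_of c \<or> d = below c" "T d \<noteq> None"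
  shows "card {e \<in> dom (move_entry T d c). fst d + snd d < fst e + snd e}
       < card {e \<in> dom T. fst c + snd c < fst e + snd e}"
proof (rule psubset_card_mono)
  have *: "fst d + snd d = Suc (fst c + snd c)"
    using assms(2) by (auto simp: right_of_def below_def)
  let ?A = "{e \<in> dom (move_entry T d c). fst d + snd d < fst e + snd e}"
  let ?B = "{e \<in> dom T. fst c + snd c < fst e + snd e}"
  show "finite ?B" using assms(1) by auto
  have "?A \<subseteq> ?B" using * by (auto simp: move_entry_def split: if_splits)
  moreover have "d \<in> ?B" "d \<notin> ?A" using * assms(3) by auto
  ultimately show "?A \<subset> ?B" by blast
qed

termination slide
  by (relation "measure (\<lambda>(T, c). card {e \<in> dom T. fst c + snd c < fst e + snd e})")
     (auto intro!: slide_measure_decreases dest: sym[of "Some _"])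

declare slide.simps [simp del]

definition delete_entry :: "filling \<Rightarrow> nat \<Rightarrow> filling" where
  "delete_entry T m =
     (let c = (THE c. T c = Some m)
      in map_option (\<lambda>x. if x > m then x - 1 else x) \<circ> slide (T(c := None)) c)"

text \<open>Summing over the first deleted entry counts each successive choice of cells separately,
  so equal minors are counted with multiplicity.\<close>

primrec mM :: "nat \<Rightarrow> filling \<Rightarrow> filling multiset" where
  "mM 0 T = {#T#}"
| "mM (Suc k) T = (\<Sum>m\<in>ran T. mM k (delete_entry T m))"

end

theory Submission
  imports Defs
begin

text \<open>Deletion commutes with restricting a tableau to its entries at most \<open>i\<close>. Put
  \<open>N = k\<^sup>2 + 2k\<close>. Deletion sequences that only remove entries above \<open>N\<close> leave the restriction
  to \<open>N\<close> untouched, and the binomial inequality says that they form a majority; this determines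
  the restriction to \<open>N\<close>. For \<open>i \<ge> N\<close>, the minors cut down to size \<open>i + 1 - k\<close> are the \<open>k\<close>-minors
  of the restriction to \<open>i + 1\<close>, plus others that depend on the restriction to \<open>i\<close> only. So it
  suffices to tell apart two one-cell extensions of a tableau of size \<open>i\<close> by their \<open>k\<close>-minors.
  Some minor keeps the new cell \<open>a\<close> unless the rectangle of cells weakly north-west of \<open>a\<close> has
  more than \<open>i + 1 - k\<close> cells; if this happens for both new cells, the two rectangles together
  leave so little room that their sides are bounded in terms of \<open>k\<close>, which forces \<open>i < N\<close>.\<close>

section \<open>Order ideals of cells, tableaux, and fillings with one hole\<close>

definition cell_le :: "cell \<Rightarrow> cell \<Rightarrow> bool" where
  "cell_le d e \<longleftrightarrow> fst d \<le> fst e \<and> snd d \<le> snd e"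

definition downclosed :: "cell set \<Rightarrow> bool" where
  "downclosed A \<longleftrightarrow> (\<forall>e\<in>A. \<forall>d. cell_le d e \<longrightarrow> d \<in> A)"

text \<open>Comparing in the product order on cells, rather than along rows and columns separately,
  lets rightward and downward moves be treated alike.\<close>

definition increasing :: "filling \<Rightarrow> bool" where
  "increasing T \<longleftrightarrow>
     (\<forall>d e x y. T d = Some x \<longrightarrow> T e = Some y \<longrightarrow> cell_le d e \<longrightarrow> d \<noteq> e \<longrightarrow> x < y)"

text \<open>A standard Young tableau whose shape is given as a finite order ideal instead of a
  partition, so that restrictions and slides never have to exhibit row lengths.\<close>

definition tab :: "nat \<Rightarrow> filling \<Rightarrow> bool" where
  "tab n T \<longleftrightarrow> finite (dom T) \<and> inj_on T (dom T) \<and> downclosed (dom T) \<and> increasing T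
     \<and> ran T = {1..n}"

text \<open>The state of a slide between two moves: the hole \<open>c\<close> is empty but still
  counts as part of the shape.\<close>

definition holed :: "filling \<Rightarrow> cell \<Rightarrow> bool" where
  "holed T c \<longleftrightarrow> finite (dom T) \<and> inj_on T (dom T) \<and> T c = None
     \<and> downclosed (insert c (dom T)) \<and> increasing T"

text \<open>One move as a relation symmetric in the two directions, so that later arguments need no
  case split between right and down.\<close>

definition jdt_next :: "filling \<Rightarrow> cell \<Rightarrow> cell \<Rightarrow> nat \<Rightarrow> bool" where
  "jdt_next T c d x \<longleftrightarrow> (d = right_of c \<or> d = below c) \<and> T d = Some x \<and>
     (\<forall>e y. (e = right_of c \<or> e = below c) \<longrightarrow> e \<noteq> d \<longrightarrow> T e = Some y \<longrightarrow> x < y)"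

definition restr :: "nat \<Rightarrow> filling \<Rightarrow> filling" where
  "restr i T = T |` {c. \<exists>x\<le>i. T c = Some x}"

lemma map_eqI:
  assumes "\<And>c x. f c = Some x \<longleftrightarrow> g c = Some x"
  shows "f = g"
proof
  fix c show "f c = g c" 
    using assms[of c "the (f c)"] assms[of c "the (g c)"] by (cases "f c"; cases "g c") simp_all
qed

lemma restr_eq_Some [simp]: "restr i T c = Some x \<longleftrightarrow> T c = Some x \<and> x \<le> i"
  by (auto simp: restr_def restrict_map_def)

lemma cell_le_strict:
  assumes "cell_le c e" "e \<noteq> c"
  shows "cell_le (right_of c) e \<or> cell_le (below c) e"
  using assms by (auto simp: cell_le_def right_of_def below_def prod_eq_iff)

lemma cell_le_trans: "cell_le c d \<Longrightarrow> cell_le d e \<Longrightarrow> cell_le c e"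
  by (auto simp: cell_le_def)

lemma inj_domD: "inj_on T (dom T) \<Longrightarrow> T d = Some x \<Longrightarrow> T e = Some x \<Longrightarrow> d = e"
  using inj_onD[of T "dom T" d e] by (simp add: domI)

lemma inj_domI: "(\<And>d e x. T d = Some x \<Longrightarrow> T e = Some x \<Longrightarrow> d = e) \<Longrightarrow> inj_on T (dom T)"
  by (rule inj_onI) (auto simp: dom_def)

lemma increasingD:
  "increasing T \<Longrightarrow> T d = Some x \<Longrightarrow> T e = Some y \<Longrightarrow> cell_le d e \<Longrightarrow> d \<noteq> e \<Longrightarrow> x < y"
  unfolding increasing_def by blast

section \<open>Single moves of jeu de taquin\<close>

lemma slide_stop:
  assumes "T (right_of c) = None" "T (below c) = None"
  shows "slide T c = T"
  using assms by (subst slide.simps) auto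

lemma slide_next:
  assumes "finite (dom T)" "jdt_next T c d x"
  shows "slide T c = slide (move_entry T d c) d"
proof -
  have ne: "right_of c \<noteq> below c" by (auto simp: right_of_def below_def)
  from assms(2) consider "d = right_of c" | "d = below c" by (auto simp: jdt_next_def)
  then show ?thesis
  proof cases
    case 1
    have "T (right_of c) = Some x" "\<And>y. T (below c) = Some y \<Longrightarrow> x < y"
      using assms(2) ne unfolding jdt_next_def 1 by metis+
    then show ?thesis
      using assms(1) 1 by (subst slide.simps) (simp split: option.splits)
  next
    case 2
    have "T (below c) = Some x" "\<And>y. T (right_of c) = Some y \<Longrightarrow> x < y"
      using assms(2) ne unfolding jdt_next_def 2 by metis+
    then show ?thesis
      using assms(1) 2 by (subst slide.simps) (auto split: option.splits dest: order.asym)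
  qed
qed

text \<open>Injectivity excludes a tie between the two neighbours.\<close>

lemma jdt_next_exists:
  assumes "inj_on T (dom T)" "T (right_of c) \<noteq> None \<or> T (below c) \<noteq> None"
  shows "\<exists>d x. jdt_next T c d x"
proof -
  have ne: "right_of c \<noteq> below c" by (auto simp: right_of_def below_def)
  consider a where "T (right_of c) = Some a" "T (below c) = None"
    | b where "T (right_of c) = None" "T (below c) = Some b"
    | a b where "T (right_of c) = Some a" "T (below c) = Some b" "a < b"
    | a b where "T (right_of c) = Some a" "T (below c) = Some b" "b < a"
  proof (cases "T (right_of c)"; cases "T (below c)")
    fix a b assume ab: "T (right_of c) = Some a" "T (below c) = Some b"
    then have "a \<noteq> b" using inj_domD[OF assms(1)] ne by metis
    then show thesis using that ab by (meson linorder_neqE_nat)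
  qed (use assms(2) that in auto)
  then show ?thesis
  proof cases
    case 1
    then have "jdt_next T c (right_of c) a" by (simp add: jdt_next_def)
    then show ?thesis by blast
  next
    case 2
    then have "jdt_next T c (below c) b" by (simp add: jdt_next_def)
    then show ?thesis by blast
  next
    case 3
    then have "jdt_next T c (right_of c) a" by (simp add: jdt_next_def)
    then show ?thesis by blast
  next
    case 4
    then have "jdt_next T c (below c) b" by (simp add: jdt_next_def)
    then show ?thesis by blast
  qed
qed

lemma jdt_next_cell:
  assumes "jdt_next T c d x"
  shows "cell_le c d" "c \<noteq> d" "T d = Some x"
proof -
  have "d = right_of c \<or> d = below c" using assms by (simp add: jdt_next_def)
  then show "cell_le c d" "c \<noteq> d"
    by (auto simp: cell_le_def right_of_def below_def prod_eq_iff)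
  show "T d = Some x" using assms by (simp add: jdt_next_def)
qed

text \<open>Any cell strictly beyond the hole lies weakly beyond one of its two neighbours
  \<open>g\<close>. That neighbour is filled because the shape is an order ideal, and its entry is
  at least \<open>x\<close>.\<close>

lemma jdt_next_least:
  assumes h: "holed T c" and n: "jdt_next T c d x" and e: "T e = Some y" "cell_le c e" "e \<noteq> d"
  shows "x < y"
proof -
  have "e \<noteq> c" using h e by (auto simp: holed_def)
  then obtain g where g: "g = right_of c \<or> g = below c" "cell_le g e"
    using cell_le_strict[OF e(2)] by blast
  have "g \<noteq> c" using g by (auto simp: right_of_def below_def prod_eq_iff)
  then obtain z where z: "T g = Some z"
    using h e(1) g(2) unfolding holed_def downclosed_def by blast
  have "x \<le> z" "g \<noteq> d \<Longrightarrow> x < z" using n g(1) z unfolding jdt_next_def by fastforce+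
  moreover have "z \<le> y" "g \<noteq> e \<Longrightarrow> z < y"
    using h e(1) z g(2) unfolding holed_def increasing_def by fastforce+
  ultimately show ?thesis using e(3) by fastforce
qed

lemma move_entry_Some:
  "move_entry T d c e = Some y \<longleftrightarrow> e \<noteq> d \<and> (e = c \<and> T d = Some y \<or> e \<noteq> c \<and> T e = Some y)"
  by (auto simp: move_entry_def)

lemma dom_move_entry:
  "T d = Some x \<Longrightarrow> c \<noteq> d \<Longrightarrow> dom (move_entry T d c) = insert c (dom T) - {d}"
  by (auto simp: move_entry_def split: if_splits)

lemma ran_move_entry:
  assumes "T c = None" "T d = Some x" "c \<noteq> d"
  shows "ran (move_entry T d c) = ran T"
proof (intro subset_antisym subsetI)
  fix y assume "y \<in> ran (move_entry T d c)"
  then obtain e where "move_entry T d c e = Some y" by (auto simp: ran_def)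
  then show "y \<in> ran T" by (auto simp: move_entry_Some intro: ranI)
next
  fix y assume "y \<in> ran T"
  then obtain e where e: "T e = Some y" by (auto simp: ran_def)
  then have "move_entry T d c (if e = d then c else e) = Some y"
    using assms by (auto simp: move_entry_Some)
  then show "y \<in> ran (move_entry T d c)" unfolding ran_def by blast
qed

text \<open>Only comparisons with the moved entry \<open>x\<close> are new. It is smaller than
  everything beyond \<open>c\<close> by \<open>jdt_next_least\<close>, and larger than everything
  before \<open>c\<close> because those cells also precede \<open>d\<close>.\<close>

lemma holed_move_entry:
  assumes h: "holed T c" and n: "jdt_next T c d x"
  shows "holed (move_entry T d c) d"
proof -
  note d = jdt_next_cell[OF n]
  have dom: "dom (move_entry T d c) = insert c (dom T) - {d}"
    using dom_move_entry d by metis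
  have "downclosed (insert d (dom (move_entry T d c)))"
  proof -
    have "insert d (dom (move_entry T d c)) = insert c (dom T)" using dom d by auto
    then show ?thesis using h by (simp add: holed_def)
  qed
  moreover have "finite (dom (move_entry T d c))" using dom h by (simp add: holed_def)
  moreover have "move_entry T d c d = None" by (simp add: move_entry_def)
  moreover have "inj_on (move_entry T d c) (dom (move_entry T d c))"
  proof (rule inj_domI)
    fix e e' y assume "move_entry T d c e = Some y" "move_entry T d c e' = Some y"
    then show "e = e'" using inj_domD[of T] h unfolding holed_def move_entry_Some by metis
  qed
  moreover have "increasing (move_entry T d c)"
    unfolding increasing_def
  proof (intro allI impI)
    fix e e' y y'
    assume e: "move_entry T d c e = Some y" "move_entry T d c e' = Some y'"
      and le: "cell_le e e'" "e \<noteq> e'"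
    have inc: "T u = Some p \<Longrightarrow> T v = Some q \<Longrightarrow> cell_le u v \<Longrightarrow> u \<noteq> v \<Longrightarrow> p < q" for u v p q
      using h unfolding holed_def increasing_def by blast
    show "y < y'"
    proof (cases "e = c")
      case True
      then have "y = x" "T e' = Some y'" "e' \<noteq> d" using e d le by (auto simp: move_entry_Some)
      then show ?thesis using jdt_next_least[OF h n] le True by blast
    next
      case False
      then have T: "T e = Some y" using e by (auto simp: move_entry_Some)
      show ?thesis
      proof (cases "e' = c")
        case True
        then have "y' = x" "e \<noteq> d" using e d by (auto simp: move_entry_Some)
        then show ?thesis using inc[OF T d(3)] cell_le_trans le True d by blast
      next
        case False
        then have "T e' = Some y'" using e by (auto simp: move_entry_Some)
        then show ?thesis using inc[OF T] le by blast
      qed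
    qed
  qed
  ultimately show ?thesis
    unfolding holed_def by blast
qed

section \<open>Whole slides and their compatibility with restriction\<close>

text \<open>Induction along the path of the hole, by the measure from the termination proof of
  \<open>slide\<close>: the number of filled cells on later antidiagonals.\<close>

lemma holed_induct [consumes 1, case_names stop move]:
  assumes "holed T c"
    and stop: "\<And>T c. holed T c \<Longrightarrow> T (right_of c) = None \<Longrightarrow> T (below c) = None \<Longrightarrow> P T c"
    and move: "\<And>T c d x. holed T c \<Longrightarrow> jdt_next T c d x \<Longrightarrow> holed (move_entry T d c) d
                 \<Longrightarrow> P (move_entry T d c) d \<Longrightarrow> P T c"
  shows "P T c"
  using assms(1)
proof (induction "card {e \<in> dom T. fst c + snd c < fst e + snd e}" arbitrary: T c rule: less_induct)
  case less
  show ?case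
  proof (cases "T (right_of c) = None \<and> T (below c) = None")
    case True
    then show ?thesis using stop less.prems by blast
  next
    case False
    then obtain d x where n: "jdt_next T c d x"
      using jdt_next_exists less.prems unfolding holed_def by metis
    have "P (move_entry T d c) d"
    proof (rule less.hyps[OF _ holed_move_entry[OF less.prems n]])
      show "card {e \<in> dom (move_entry T d c). fst d + snd d < fst e + snd e}
          < card {e \<in> dom T. fst c + snd c < fst e + snd e}"
        using n less.prems by (intro slide_measure_decreases) (auto simp: holed_def jdt_next_def)
    qed
    then show ?thesis using move[OF less.prems n holed_move_entry[OF less.prems n]] by blast
  qed
qed

lemma slide_holed:
  assumes "holed T c"
  shows "finite (dom (slide T c)) \<and> inj_on (slide T c) (dom (slide T c)) \<and>
         downclosed (dom (slide T c)) \<and> increasing (slide T c) \<and>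
         ran (slide T c) = ran T \<and> dom (slide T c) \<subseteq> insert c (dom T)"
  using assms
proof (induction rule: holed_induct)
  case (stop T c)
  have "downclosed (dom T)"
    unfolding downclosed_def
  proof (intro ballI allI impI)
    fix e d assume e: "e \<in> dom T" "cell_le d e"
    have dc: "downclosed (insert c (dom T))" using stop by (auto simp: holed_def)
    have "d \<noteq> c"
    proof
      assume "d = c"
      moreover have "e \<noteq> c" using e stop by (auto simp: holed_def)
      ultimately have "cell_le (right_of c) e \<or> cell_le (below c) e"
        using cell_le_strict e by blast
      then have "right_of c \<in> insert c (dom T) \<or> below c \<in> insert c (dom T)"
        using dc e(1) unfolding downclosed_def by blast
      then show False using stop by (auto simp: right_of_def below_def prod_eq_iff)
    qed
    then show "d \<in> dom T" using dc e unfolding downclosed_def by blast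
  qed
  then show ?case using stop by (auto simp: slide_stop holed_def)
next
  case (move T c d x)
  note d = jdt_next_cell[OF move(2)]
  have "slide T c = slide (move_entry T d c) d"
    using slide_next move by (auto simp: holed_def)
  moreover have "ran (move_entry T d c) = ran T"
    using ran_move_entry d move by (auto simp: holed_def)
  moreover have "insert d (dom (move_entry T d c)) = insert c (dom T)"
    using dom_move_entry[of T d x c] d by auto
  ultimately show ?case using move.IH by simp
qed

text \<open>While the moved entry is at most \<open>j\<close>, the restricted filling makes the same
  move. Once it exceeds \<open>j\<close>, so does everything beyond the hole: the restricted slide
  stops there, and the remaining moves only shuffle entries above \<open>j\<close>.\<close>

lemma restr_slide:
  assumes "holed T c"
  shows "restr j (slide T c) = slide (restr j T) c"
  using assms
proof (induction rule: holed_induct)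
  case (stop T c)
  have "restr j T (right_of c) = None" "restr j T (below c) = None"
    using stop by (auto simp: restr_def restrict_map_def)
  then show ?case using stop by (simp add: slide_stop)
next
  case (move T c d x)
  note d = jdt_next_cell[OF move(2)]
  have fin: "finite (dom T)" using move by (auto simp: holed_def)
  have sl: "slide T c = slide (move_entry T d c) d" using slide_next[OF fin move(2)] .
  show ?case
  proof (cases "x \<le> j")
    case True
    have n: "jdt_next (restr j T) c d x"
      using move(2) True by (auto simp: jdt_next_def)
    have "finite (dom (restr j T))" using fin by (auto intro: finite_subset[rotated])
    from slide_next[OF this n]
    have "slide (restr j T) c = slide (move_entry (restr j T) d c) d" .
    moreover have "move_entry (restr j T) d c = restr j (move_entry T d c)"
      by (rule map_eqI) (auto simp: move_entry_Some)
    ultimately show ?thesis using sl move.IH by simp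
  next
    case False
    have Tc: "T c = None" using move by (auto simp: holed_def)
    have eq: "restr j (move_entry T d c) = restr j T"
      using False d Tc by (intro map_eqI) (auto simp: move_entry_Some)
    have big: "\<not> y \<le> j" if "T e = Some y" "cell_le c e" for e y
      using jdt_next_least[OF move(1,2) that] False d(3) that(1) by (cases "e = d") auto
    have none: "restr j T e = None" if "cell_le c e" for e
      using big[OF _ that] by (cases "restr j T e") auto
    have "cell_le c (right_of d)" "cell_le c (below d)"
      "cell_le c (right_of c)" "cell_le c (below c)"
      using d by (auto simp: cell_le_def right_of_def below_def)
    then show ?thesis using sl move.IH eq none by (simp add: slide_stop)
  qed
qed

section \<open>Deletion in tableaux and its effect on restrictions\<close>

definition shift_down :: "nat \<Rightarrow> nat \<Rightarrow> nat" where
  "shift_down m x = (if x > m then x - 1 else x)"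

lemma delete_entry_eq:
  assumes "inj_on T (dom T)" "T c = Some m"
  shows "delete_entry T m = map_option (shift_down m) \<circ> slide (T(c := None)) c"
proof -
  have "(THE c. T c = Some m) = c" 
  proof (rule the_equality)
    show "d = c" if "T d = Some m" for d using inj_domD[OF assms(1) that assms(2)] .
  qed (rule assms(2))
  then show ?thesis by (simp add: delete_entry_def shift_down_def[abs_def])
qed

lemma tab_inj: "tab n T \<Longrightarrow> inj_on T (dom T)"
  by (simp add: tab_def)

lemma tab_le:
  assumes "tab n T" "T d = Some x" "T e = Some y" "cell_le d e"
  shows "x \<le> y"
proof (cases "d = e")
  case False
  then show ?thesis using increasingD[OF _ assms(2-4)] assms(1) by (simp add: tab_def less_imp_le)
qed (use assms in simp)

lemma inj_restr:
  assumes "inj_on T (dom T)"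
  shows "inj_on (restr i T) (dom (restr i T))"
proof (rule inj_domI)
  fix d e x assume "restr i T d = Some x" "restr i T e = Some x"
  then show "d = e" using inj_domD[OF assms] by simp
qed

lemma tab_range: "tab n T \<Longrightarrow> T c = Some x \<Longrightarrow> 1 \<le> x \<and> x \<le> n"
  using ranI[of T c x] by (simp add: tab_def)

lemma tab_obtain:
  assumes "tab n T" "1 \<le> m" "m \<le> n"
  obtains c where "T c = Some m"
proof -
  have "m \<in> ran T" using assms by (auto simp: tab_def)
  then show ?thesis using that by (auto simp: ran_def)
qed

lemma tab_holed:
  assumes "tab n T" "T c = Some m"
  shows "holed (T(c := None)) c" "ran (T(c := None)) = {1..n} - {m}"
proof -
  have ins: "insert c (dom (T(c := None))) = dom T" using assms by auto
  have "increasing (T(c := None))"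
    using assms unfolding tab_def increasing_def by auto
  moreover have "inj_on (T(c := None)) (dom (T(c := None)))"
    using assms unfolding tab_def by (intro inj_domI) (auto dest: inj_domD split: if_splits)
  ultimately show "holed (T(c := None)) c"
    using assms ins unfolding tab_def holed_def by auto
  have inj: "inj_on T (dom T)" using assms(1) by (simp add: tab_def)
  have "ran (T(c := None)) = ran T - {m}"
  proof (intro subset_antisym subsetI)
    fix y assume "y \<in> ran (T(c := None))"
    then obtain e where "e \<noteq> c" "T e = Some y" by (auto simp: ran_def split: if_splits)
    then show "y \<in> ran T - {m}" using inj_domD[OF inj _ assms(2), of e] by (auto intro: ranI)
  next
    fix y assume y: "y \<in> ran T - {m}"
    then obtain e where e: "T e = Some y" by (auto simp: ran_def)
    then have "(T(c := None)) e = Some y" using y assms(2) by auto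
    then show "y \<in> ran (T(c := None))" by (rule ranI)
  qed
  then show "ran (T(c := None)) = {1..n} - {m}" using assms by (simp add: tab_def)
qed

lemma shift_down_strict:
  "x \<noteq> m \<Longrightarrow> y \<noteq> m \<Longrightarrow> x < y \<Longrightarrow> shift_down m x < shift_down m y"
  by (auto simp: shift_down_def)

lemma shift_down_image:
  assumes "1 \<le> m" "m \<le> n"
  shows "shift_down m ` ({1..n} - {m}) = {1..n - 1}"
proof (intro subset_antisym subsetI)
  fix y assume "y \<in> shift_down m ` ({1..n} - {m})"
  then show "y \<in> {1..n - 1}" using assms by (auto simp: shift_down_def split: if_splits)
next
  fix y assume y: "y \<in> {1..n - 1}"
  show "y \<in> shift_down m ` ({1..n} - {m})"
  proof (cases "y < m")
    case True
    then have "y = shift_down m y" "y \<in> {1..n} - {m}"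
      using y assms by (auto simp: shift_down_def)
    then show ?thesis by blast
  next
    case False
    then have "y = shift_down m (Suc y)" "Suc y \<in> {1..n} - {m}"
      using y assms by (auto simp: shift_down_def)
    then show ?thesis by blast
  qed
qed

text \<open>After the slide the value \<open>m\<close> is absent, and on the other values the
  renumbering is strictly monotone, so order and injectivity carry over.\<close>

lemma tab_delete_entry:
  assumes t: "tab n T" and m: "1 \<le> m" "m \<le> n"
  shows "tab (n - 1) (delete_entry T m)" "dom (delete_entry T m) \<subseteq> dom T"
proof -
  obtain c where c: "T c = Some m" using tab_obtain[OF t m] .
  define U where "U = slide (T(c := None)) c"
  have del: "delete_entry T m = map_option (shift_down m) \<circ> U"
    unfolding U_def by (rule delete_entry_eq[OF tab_inj[OF t] c])
  have U: "finite (dom U)" "inj_on U (dom U)" "downclosed (dom U)" "increasing U"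
    "ran U = {1..n} - {m}" "dom U \<subseteq> dom T"
    using slide_holed[OF tab_holed(1)[OF t c]] tab_holed(2)[OF t c] c unfolding U_def by auto
  have ne: "x \<noteq> m" if "U d = Some x" for d x
    using ranI[of U d x, OF that] U(5) by auto
  have inj: "p = q" if "shift_down m p = shift_down m q" "p \<noteq> m" "q \<noteq> m" for p q
    using that shift_down_strict[of p m q] shift_down_strict[of q m p] by (cases p q rule: linorder_cases) auto
  have dom: "dom (delete_entry T m) = dom U" by (auto simp: del)
  have "ran (delete_entry T m) = shift_down m ` ran U" by (auto simp: del ran_def)
  then have "ran (delete_entry T m) = {1..n - 1}" using U(5) shift_down_image[OF m] by simp
  moreover have "increasing (delete_entry T m)"
    unfolding increasing_def
  proof (intro allI impI)
    fix d e x y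
    assume "delete_entry T m d = Some x" "delete_entry T m e = Some y" and le: "cell_le d e" "d \<noteq> e"
    then obtain p q where pq: "U d = Some p" "U e = Some q" and xy: "shift_down m p = x" "shift_down m q = y"
      by (auto simp: del)
    then show "x < y"
      using shift_down_strict[OF ne[OF pq(1)] ne[OF pq(2)] increasingD[OF U(4) pq le]] by simp
  qed
  moreover have "inj_on (delete_entry T m) (dom (delete_entry T m))"
  proof (rule inj_domI)
    fix d e x assume "delete_entry T m d = Some x" "delete_entry T m e = Some x"
    then obtain p q where pq: "U d = Some p" "U e = Some q"
      and "shift_down m p = x" "shift_down m q = x"
      by (auto simp: del)
    then have "p = q" using inj[OF _ ne[OF pq(1)] ne[OF pq(2)]] by simp
    then show "d = e" using inj_domD[OF U(2)] pq by blast
  qed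
  ultimately show "tab (n - 1) (delete_entry T m)" using U dom by (simp add: tab_def)
  show "dom (delete_entry T m) \<subseteq> dom T" using U dom by simp
qed

lemma tab_restr:
  assumes "tab n T" "i \<le> n"
  shows "tab i (restr i T)"
proof -
  have "inj_on (restr i T) (dom (restr i T))"
    using inj_restr[OF tab_inj[OF assms(1)]] .
  moreover have "increasing (restr i T)"
  proof -
    have inc: "increasing T" using assms by (simp add: tab_def)
    show ?thesis unfolding increasing_def restr_eq_Some using increasingD[OF inc] by blast
  qed
  moreover have "finite (dom (restr i T))"
    using assms by (simp add: tab_def restr_def)
  moreover have "ran (restr i T) = ran T \<inter> {..i}" by (auto simp: ran_def)
  moreover have "downclosed (dom (restr i T))"
    unfolding downclosed_def
  proof (intro ballI allI impI)
    fix e d assume e: "e \<in> dom (restr i T)" and le: "cell_le d e"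
    then obtain x where x: "T e = Some x" "x \<le> i" by auto
    have "downclosed (dom T)" using assms by (simp add: tab_def)
    then have "d \<in> dom T" using x(1) le unfolding downclosed_def by blast
    then obtain y where y: "T d = Some y" by auto
    have "y \<le> x" using tab_le[OF assms(1) y x(1) le] .
    then show "d \<in> dom (restr i T)" using x y by auto
  qed
  ultimately show ?thesis using assms by (auto simp: tab_def)
qed

text \<open>Renumbering sends exactly the surviving entries up to \<open>Suc i\<close> to those up
  to \<open>i\<close>, which accounts for the shift of level; the slides agree by
  \<open>restr_slide\<close>.\<close>

lemma restr_delete_entry_le:
  assumes t: "tab n T" and m: "1 \<le> m" "m \<le> n" "m \<le> Suc i"
  shows "restr i (delete_entry T m) = delete_entry (restr (Suc i) T) m"
proof -
  obtain c where c: "T c = Some m" using tab_obtain[OF t m(1,2)] .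
  define U where "U = slide (T(c := None)) c"
  have h: "holed (T(c := None)) c" "ran (T(c := None)) = {1..n} - {m}" using tab_holed[OF t c] .
  have "ran U = {1..n} - {m}" using slide_holed[OF h(1)] h(2) unfolding U_def by auto
  then have ne: "x \<noteq> m" if "U d = Some x" for d x
    using ranI[of U d x, OF that] by auto
  have inj: "inj_on (restr (Suc i) T) (dom (restr (Suc i) T))"
    using inj_restr[OF tab_inj[OF t]] .
  have "(restr (Suc i) T)(c := None) = restr (Suc i) (T(c := None))"
    by (rule map_eqI) (auto split: if_splits)
  then have "delete_entry (restr (Suc i) T) m = map_option (shift_down m) \<circ> restr (Suc i) U"
    using delete_entry_eq[OF inj, of c m] c m restr_slide[OF h(1)] by (simp add: U_def)
  moreover have "delete_entry T m = map_option (shift_down m) \<circ> U"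
    unfolding U_def by (rule delete_entry_eq[OF tab_inj[OF t] c])
  moreover have "restr i (map_option (shift_down m) \<circ> U) = map_option (shift_down m) \<circ> restr (Suc i) U"
  proof (rule map_eqI)
    fix e y
    have "shift_down m x \<le> i \<longleftrightarrow> x \<le> Suc i" if "U e = Some x" for x
      using ne[OF that] m by (auto simp: shift_down_def)
    then show "restr i (map_option (shift_down m) \<circ> U) e = Some y \<longleftrightarrow>
        (map_option (shift_down m) \<circ> restr (Suc i) U) e = Some y" by auto
  qed
  ultimately show ?thesis by simp
qed

text \<open>All entries beyond the deleted cell exceed \<open>i\<close>, so the restricted slide
  stops at once. Entries above \<open>m\<close> are still at least \<open>m\<close>, hence above
  \<open>i\<close>, after being lowered by 1.\<close>

lemma restr_delete_entry_gt:
  assumes t: "tab n T" and m: "m \<le> n" "i < m"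
  shows "restr i (delete_entry T m) = restr i T"
proof -
  have m1: "1 \<le> m" using m by simp
  obtain c where c: "T c = Some m" using tab_obtain[OF t m1 m(1)] .
  define U where "U = slide (T(c := None)) c"
  have h: "holed (T(c := None)) c" "ran (T(c := None)) = {1..n} - {m}" using tab_holed[OF t c] .
  have "ran U = {1..n} - {m}" using slide_holed[OF h(1)] h(2) unfolding U_def by auto
  then have ne: "x \<noteq> m" if "U d = Some x" for d x
    using ranI[of U d x, OF that] by auto
  have none: "restr i T e = None" if "cell_le c e" for e
  proof (rule ccontr)
    assume "restr i T e \<noteq> None"
    then obtain x where "T e = Some x" "x \<le> i" by auto
    moreover have "m \<le> x" using tab_le[OF t c calculation(1) that] .
    ultimately show False using m by simp
  qed
  have "restr i (T(c := None)) = restr i T"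
    using c m by (intro map_eqI) auto
  then have "restr i U = restr i T"
    using restr_slide[OF h(1), of i] none
    by (simp add: U_def slide_stop cell_le_def right_of_def below_def)
  moreover have "delete_entry T m = map_option (shift_down m) \<circ> U"
    unfolding U_def by (rule delete_entry_eq[OF tab_inj[OF t] c])
  moreover have "restr i (map_option (shift_down m) \<circ> U) = restr i U"
  proof (rule map_eqI)
    fix e y
    have "shift_down m x = y \<and> y \<le> i \<longleftrightarrow> x = y \<and> y \<le> i" if "U e = Some x" for x
      using ne[OF that] m by (auto simp: shift_down_def)
    then show "restr i (map_option (shift_down m) \<circ> U) e = Some y \<longleftrightarrow> restr i U e = Some y" by auto
  qed
  ultimately show ?thesis by simp
qed

section \<open>Restrictions of minors, as multisets\<close>

lemma mM_Suc_tab: "tab n T \<Longrightarrow> mM (Suc k) T = (\<Sum>m\<in>{1..n}. mM k (delete_entry T m))"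
  by (simp add: tab_def)

lemma image_mset_sum: "image_mset f (\<Sum>m\<in>A. g m) = (\<Sum>m\<in>A. image_mset f (g m))"
  by (induction A rule: infinite_finite_induct) auto

lemma size_sum_mset: "size (\<Sum>m\<in>A. g m :: 'b multiset) = (\<Sum>m\<in>A. size (g m))"
  by (induction A rule: infinite_finite_induct) auto

text \<open>Each deletion costs at most one level of agreement, so agreement up to
  \<open>i + k\<close> leaves agreement up to \<open>i\<close> after \<open>k\<close>
  deletions.\<close>

lemma mM_restr_cong:
  assumes "tab n T" "tab n S" "restr (i + k) T = restr (i + k) S"
  shows "image_mset (restr i) (mM k T) = image_mset (restr i) (mM k S)"
  using assms
proof (induction k arbitrary: n T S)
  case 0
  then show ?case by simp
next
  case (Suc k)
  have "image_mset (restr i) (mM k (delete_entry T m)) = image_mset (restr i) (mM k (delete_entry S m))"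
    if m: "m \<in> {1..n}" for m
  proof (rule Suc.IH)
    show "tab (n - 1) (delete_entry T m)" "tab (n - 1) (delete_entry S m)"
      using tab_delete_entry(1) Suc.prems m by auto
    show "restr (i + k) (delete_entry T m) = restr (i + k) (delete_entry S m)"
    proof (cases "m \<le> Suc (i + k)")
      case True
      then show ?thesis using restr_delete_entry_le Suc.prems m by simp
    next
      case False
      have "restr (i + k) T = restr (i + k) S"
      proof (rule map_eqI)
        fix c x
        show "restr (i + k) T c = Some x \<longleftrightarrow> restr (i + k) S c = Some x"
          using restr_eq_Some[of "i + Suc k" T c x] restr_eq_Some[of "i + Suc k" S c x] Suc.prems(3)
          by (auto simp del: restr_eq_Some) (auto)
      qed
      then show ?thesis using restr_delete_entry_gt Suc.prems m False by simp
    qed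
  qed
  then show ?case using Suc.prems by (simp add: mM_Suc_tab image_mset_sum del: mM.simps)
qed

text \<open>The cut minors of \<open>T\<close> are the minors of \<open>restr (i + k) T\<close> plus
  a part that depends only on lower levels. The equation is additive to avoid truncated multiset
  difference. A first deletion above \<open>Suc (i + k)\<close> contributes equally on both sides by
  \<open>mM_restr_cong\<close>; the others are handled by induction.\<close>

lemma mM_restr_exchange:
  assumes "tab n T" "tab n S" "\<And>j. j < i + k \<Longrightarrow> restr j T = restr j S" "i + k \<le> n"
  shows "image_mset (restr i) (mM k T) + mM k (restr (i + k) S)
       = image_mset (restr i) (mM k S) + mM k (restr (i + k) T)"
  using assms
proof (induction k arbitrary: n T S)
  case 0
  then show ?case by simp
next
  case (Suc k)
  note tT = Suc.prems(1) and tS = Suc.prems(2)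
  let ?A = "{1..Suc (i + k)}" and ?B = "{Suc (Suc (i + k))..n}"
  have split: "{1..n} = ?A \<union> ?B" "?A \<inter> ?B = {}" using Suc.prems(4) by auto
  let ?f = "\<lambda>T m. image_mset (restr i) (mM k (delete_entry T m))"
  have img: "image_mset (restr i) (mM (Suc k) V) = sum (?f V) ?A + sum (?f V) ?B"
    if "tab n V" for V
    using that split
    by (simp add: mM_Suc_tab image_mset_sum sum.union_disjoint del: mM.simps)
  have low: "mM (Suc k) (restr (i + Suc k) V) = (\<Sum>m\<in>?A. mM k (restr (i + k) (delete_entry V m)))"
    if V: "tab n V" for V
  proof -
    have "mM (Suc k) (restr (i + Suc k) V) = (\<Sum>m\<in>?A. mM k (delete_entry (restr (Suc (i + k)) V) m))"
      using mM_Suc_tab[OF tab_restr[OF V Suc.prems(4)]] by simp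
    then show ?thesis
      using restr_delete_entry_le[OF V, where i = "i + k"] Suc.prems(4) by simp
  qed
  have B: "?f T m = ?f S m" if m: "m \<in> ?B" for m
  proof (rule mM_restr_cong)
    show "tab (n - 1) (delete_entry T m)" "tab (n - 1) (delete_entry S m)"
      using tab_delete_entry(1) tT tS m by auto
    show "restr (i + k) (delete_entry T m) = restr (i + k) (delete_entry S m)"
      using restr_delete_entry_gt[OF tT, of m "i + k"] restr_delete_entry_gt[OF tS, of m "i + k"] m
        Suc.prems(3)[of "i + k"] by simp
  qed
  have A: "?f T m + mM k (restr (i + k) (delete_entry S m))
         = ?f S m + mM k (restr (i + k) (delete_entry T m))" if m: "m \<in> ?A" for m
  proof (rule Suc.IH)
    show "tab (n - 1) (delete_entry T m)" "tab (n - 1) (delete_entry S m)"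
      using tab_delete_entry(1) tT tS m Suc.prems(4) by auto
    show "i + k \<le> n - 1" using Suc.prems(4) by simp
    \<comment> \<open>If \<open>m \<le> Suc j\<close>, agreement at level \<open>Suc j\<close>
      decides, which is still below \<open>i + Suc k\<close>; otherwise level \<open>j\<close>
      does.\<close>
    show "restr j (delete_entry T m) = restr j (delete_entry S m)" if j: "j < i + k" for j
      using restr_delete_entry_le[OF tT, of m j] restr_delete_entry_le[OF tS, of m j]
        restr_delete_entry_gt[OF tT, of m j] restr_delete_entry_gt[OF tS, of m j]
        Suc.prems(3)[of j] Suc.prems(3)[of "Suc j"] m j Suc.prems(4)
      by (cases "m \<le> Suc j") auto
  qed
  have "sum (?f T) ?A + (\<Sum>m\<in>?A. mM k (restr (i + k) (delete_entry S m)))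
      = sum (?f S) ?A + (\<Sum>m\<in>?A. mM k (restr (i + k) (delete_entry T m)))"
    unfolding sum.distrib[symmetric] using A by (rule sum.cong[OF refl])
  moreover have "sum (?f T) ?B = sum (?f S) ?B" using B by (intro sum.cong) auto
  ultimately show ?case
    unfolding img[OF tT] img[OF tS] low[OF tT] low[OF tS] by (simp add: ac_simps)
qed

section \<open>Counting deletion sequences, and the majority argument\<close>

text \<open>Splits the first factor off the falling factorial, which counts deletion
  sequences.\<close>

lemma fact_binomial_Suc:
  "fact (Suc k) * (n choose Suc k) = n * (fact k * ((n - 1) choose k))"
proof -
  have "fact (Suc k) * (n choose Suc k) = fact k * (Suc k * (n choose Suc k))"
    by (simp add: algebra_simps)
  then show ?thesis unfolding binomial_absorption by (simp only: mult.left_commute)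
qed

lemma size_mM:
  assumes "tab n T"
  shows "size (mM k T) = fact k * (n choose k)"
  using assms
proof (induction k arbitrary: n T)
  case 0
  then show ?case by simp
next
  case (Suc k)
  have "size (mM (Suc k) T) = (\<Sum>m\<in>{1..n}. fact k * ((n - 1) choose k))"
    unfolding mM_Suc_tab[OF Suc.prems] size_sum_mset
    using Suc.IH tab_delete_entry(1)[OF Suc.prems] by (intro sum.cong) auto
  then show ?case by (simp add: fact_binomial_Suc del: fact_Suc)
qed

text \<open>The left side counts the sequences that delete an entry above \<open>N\<close> every
  time; each of them preserves the restriction to \<open>N\<close>.\<close>

lemma count_mM_restr:
  assumes "tab n T"
  shows "fact k * ((n - N) choose k) \<le> count (image_mset (restr N) (mM k T)) (restr N T)"
  using assms
proof (induction k arbitrary: n T)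
  case 0
  then show ?case by simp
next
  case (Suc k)
  let ?g = "\<lambda>m. count (image_mset (restr N) (mM k (delete_entry T m))) (restr N T)"
  have "fact (Suc k) * ((n - N) choose Suc k) = (\<Sum>m\<in>{Suc N..n}. fact k * ((n - 1 - N) choose k))"
    by (simp add: fact_binomial_Suc del: fact_Suc)
  also have "\<dots> \<le> (\<Sum>m\<in>{Suc N..n}. ?g m)"
  proof (rule sum_mono)
    fix m assume m: "m \<in> {Suc N..n}"
    then have "restr N (delete_entry T m) = restr N T"
      using restr_delete_entry_gt[OF Suc.prems] by simp
    then show "fact k * ((n - 1 - N) choose k) \<le> ?g m"
      using Suc.IH[OF tab_delete_entry(1)[OF Suc.prems, of m]] m by simp
  qed
  also have "\<dots> \<le> (\<Sum>m\<in>{1..n}. ?g m)" by (rule sum_mono2) auto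
  also have "\<dots> = count (image_mset (restr N) (mM (Suc k) T)) (restr N T)"
    unfolding mM_Suc_tab[OF Suc.prems] image_mset_sum count_sum ..
  finally show ?case .
qed

lemma count_two_le_size:
  assumes "x \<noteq> y"
  shows "count M x + count M y \<le> size M"
proof -
  have "replicate_mset (count M x) x + replicate_mset (count M y) y \<subseteq># M"
    using assms by (auto simp: subseteq_mset_def)
  from size_mset_mono[OF this] show ?thesis by simp
qed

text \<open>Two different restrictions would each account for more than half of the same
  multiset.\<close>

lemma restr_majority:
  assumes "tab n T" "tab n S" "mM k S = mM k T" "2 * ((n - N) choose k) > (n choose k)"
  shows "restr N S = restr N T"
proof (rule ccontr)
  let ?M = "image_mset (restr N) (mM k T)"
  assume "restr N S \<noteq> restr N T"
  then have "count ?M (restr N S) + count ?M (restr N T) \<le> fact k * (n choose k)"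
    using count_two_le_size[of _ _ ?M] size_mM[OF assms(1), of k] by simp
  moreover have "fact k * ((n - N) choose k) \<le> count ?M (restr N S)"
    using count_mM_restr[OF assms(2), of k N] assms(3) by simp
  moreover have "fact k * ((n - N) choose k) \<le> count ?M (restr N T)"
    using count_mM_restr[OF assms(1)] .
  ultimately have "fact k * (2 * ((n - N) choose k)) \<le> fact k * (n choose k)"
    by (simp only: mult_2 distrib_left)
  then show False using assms(4) by (simp only: mult_le_cancel1) simp
qed

section \<open>Cells occupied by minors, and one-cell extensions\<close>

text \<open>Serves as an obstruction: a minor occupying a cell outside a shape cannot come from a
  tableau of that shape.\<close>

lemma dom_mM:
  assumes "tab n T" "M \<in># mM k T"
  shows "dom M \<subseteq> dom T"
  using assms
proof (induction k arbitrary: n T)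
  case 0
  then show ?case by simp
next
  case (Suc k)
  have "M \<in># (\<Sum>m\<in>{1..n}. mM k (delete_entry T m))"
    using Suc.prems mM_Suc_tab by metis
  then obtain m where m: "m \<in> {1..n}" "M \<in># mM k (delete_entry T m)"
    by (auto simp: set_mset_sum)
  then show ?case
    using Suc.IH[OF tab_delete_entry(1)] tab_delete_entry(2) Suc.prems(1)
    by (metis atLeastAtMost_iff subset_trans)
qed

definition rect :: "cell \<Rightarrow> cell set" where
  "rect a = {c. cell_le c a}"

lemma rect_eq: "rect a = {..fst a} \<times> {..snd a}"
  by (auto simp: rect_def cell_le_def)

lemma finite_rect [simp]: "finite (rect a)"
  and card_rect: "card (rect a) = Suc (fst a) * Suc (snd a)"
  by (simp_all add: rect_eq)

lemma tab_card:
  assumes "tab n T"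
  shows "card (dom T) = n"
proof -
  have "Some ` ran T = T ` dom T" by (force simp: ran_def)
  moreover have "card (Some ` ran T) = n" using assms by (simp add: card_image tab_def)
  ultimately show ?thesis using assms card_image[of T "dom T"] by (simp add: tab_def)
qed

text \<open>Deleting maximal cells outside the rectangle spanned by \<open>a\<close> involves no sliding.\<close>

lemma mM_retains_cell:
  assumes "tab n T" "a \<in> dom T" "card (rect a) + k \<le> n"
  shows "\<exists>M. M \<in># mM k T \<and> a \<in> dom M"
  using assms
proof (induction k arbitrary: n T)
  case 0
  then show ?case by auto
next
  case (Suc k)
  have fin: "finite (dom T)" using Suc.prems by (simp add: tab_def)
  let ?X = "dom T - rect a"
  have "\<not> dom T \<subseteq> rect a"
    using card_mono[of "rect a" "dom T"] tab_card Suc.prems by fastforce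
  then have X: "?X \<noteq> {}" "finite ?X" using fin by auto
  let ?s = "\<lambda>c :: cell. fst c + snd c"
  \<comment> \<open>Take a cell outside the rectangle on the furthest antidiagonal. Its neighbours
    are outside the rectangle too and further out, hence empty.\<close>
  have "Max (?s ` ?X) \<in> ?s ` ?X" using X by (intro Max_in) auto
  then obtain c where c: "c \<in> ?X" and max: "Max (?s ` ?X) = ?s c" by blast
  have le: "?s e \<le> ?s c" if "e \<in> ?X" for e
    using X(2) that unfolding max[symmetric] by (intro Max_ge) auto
  have none: "T (right_of c) = None" "T (below c) = None"
  proof -
    have "\<not> cell_le c a" using c by (simp add: rect_def)
    then have "right_of c \<notin> rect a" "below c \<notin> rect a"
      by (auto simp: rect_def cell_le_def right_of_def below_def)
    then show "T (right_of c) = None" "T (below c) = None"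
      using le[of "right_of c"] le[of "below c"] by (auto simp: right_of_def below_def)
  qed
  obtain m where m: "T c = Some m" using c by auto
  have mn: "m \<in> {1..n}" using tab_range[OF Suc.prems(1) m] by simp
  have "delete_entry T m = map_option (shift_down m) \<circ> T(c := None)"
    using delete_entry_eq[OF tab_inj[OF Suc.prems(1)] m] slide_stop[of "T(c := None)" c] none by simp
  moreover have "a \<noteq> c" using c by (auto simp: rect_def cell_le_def)
  ultimately have a: "a \<in> dom (delete_entry T m)" using Suc.prems(2) by auto
  have "tab (n - 1) (delete_entry T m)" using tab_delete_entry(1)[OF Suc.prems(1)] mn by simp
  then obtain M where M: "M \<in># mM k (delete_entry T m)" "a \<in> dom M"
    using Suc.IH[OF _ a] Suc.prems(3) by fastforce
  then have "M \<in># mM (Suc k) T"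
    unfolding mM_Suc_tab[OF Suc.prems(1)] set_mset_sum[OF finite_atLeastAtMost] using mn by blast
  then show ?case using M(2) by blast
qed

lemma tab_extension:
  assumes "tab (Suc i) U"
  obtains a where "U a = Some (Suc i)" "dom U = insert a (dom (restr i U))"
    "a \<notin> dom (restr i U)" "U = (restr i U)(a \<mapsto> Suc i)"
proof -
  obtain a where a: "U a = Some (Suc i)" 
    using tab_obtain[OF assms, of "Suc i"] by (metis le_add1 order_refl plus_1_eq_Suc)
  have iff: "U c = Some x \<longleftrightarrow> c = a \<and> x = Suc i \<or> U c = Some x \<and> x \<le> i" for c x
  proof -
    have "U c = Some x \<Longrightarrow> x \<le> Suc i" using tab_range[OF assms] by blast
    moreover have "U c = Some (Suc i) \<Longrightarrow> c = a" using inj_domD[OF tab_inj[OF assms] _ a] by blast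
    ultimately show ?thesis using a by (auto simp: le_Suc_eq)
  qed
  have U: "U = (restr i U)(a \<mapsto> Suc i)"
  proof (rule map_eqI)
    fix c x show "U c = Some x \<longleftrightarrow> ((restr i U)(a \<mapsto> Suc i)) c = Some x"
      using iff[of c x] a by auto
  qed
  moreover have "dom U = insert a (dom (restr i U))" using U by (metis dom_fun_upd option.distinct(1))
  moreover have "a \<notin> dom (restr i U)" using a by auto
  ultimately show ?thesis using that a by blast
qed

text \<open>Here \<open>a\<close> lies strictly to the north-east of \<open>b\<close>, and both
  rectangles fit into \<open>W\<close> with two extra cells. Counting their union bounds the part of
  each rectangle outside the other by \<open>k\<close>, and these bounds in turn limit the sides of
  the intersection.\<close>

lemma rect_small:
  assumes W: "finite W" and a: "downclosed (insert a W)" "a \<notin> W"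
    and b: "downclosed (insert b W)" "b \<notin> W"
    and lt: "fst a < fst b" "snd b < snd a"
    and big: "card W + 2 \<le> card (rect a) + k" "card W + 2 \<le> card (rect b) + k"
  shows "card W + 2 \<le> k^2 + 2 * k"
proof -
  have sa: "rect a - {a} \<subseteq> W" "rect b - {b} \<subseteq> W"
    using a b unfolding downclosed_def rect_def by blast+
  have "rect a \<union> rect b \<subseteq> insert a (insert b W)" using sa by blast
  then have "card (rect a \<union> rect b) \<le> card (insert a (insert b W))"
    using W by (intro card_mono) auto
  also have "\<dots> \<le> card W + 2" by (simp add: card_insert_if W)
  finally have un: "card (rect a \<union> rect b) \<le> card W + 2" .
  \<comment> \<open>The intersection is \<open>p\<close> by \<open>q\<close>; \<open>rect a\<close>
    extends it by \<open>y\<close> columns and \<open>rect b\<close> by \<open>x\<close>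
    rows.\<close>
  obtain p q x y where pq: "Suc (fst a) = p" "Suc (snd b) = q" "Suc (fst b) = p + x" "Suc (snd a) = q + y"
    using lt by (metis Suc_leI add_Suc less_imp_add_positive)
  have "rect a \<inter> rect b = {..fst a} \<times> {..snd b}" using lt by (auto simp: rect_eq)
  then have int: "card (rect a \<inter> rect b) = p * q" using pq by simp
  have ra: "card (rect a) = p * q + p * y" and rb: "card (rect b) = p * q + x * q"
    using pq by (simp_all add: card_rect algebra_simps)
  have "card (rect a) + card (rect b) = card (rect a \<union> rect b) + card (rect a \<inter> rect b)"
    by (intro card_Un_Int) auto
  then have "p * q + p * y + x * q \<le> card W + 2" using un int ra rb by simp
  \<comment> \<open>Comparing the size of the union with the lower bound on one rectangle bounds the
    overhang of the other.\<close>
  then have k: "x * q \<le> k" "p * y \<le> k" using big ra rb by auto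
  have "x > 0" "y > 0" using lt pq by auto
  then have "p \<le> k" "q \<le> k" using k
    by (metis One_nat_def Suc_leI mult.right_neutral mult_le_mono2 order_trans,
        metis One_nat_def Suc_leI mult.left_neutral mult_le_mono1 order_trans)
  then have "p * q \<le> k^2" by (simp add: power2_eq_square mult_le_mono)
  \<comment> \<open>The final bound is \<open>p * q + p * y + k\<close>, with summands at most
    \<open>k^2\<close>, \<open>k\<close> and \<open>k\<close>.\<close>
  then show ?thesis using big(1) ra k by simp
qed

text \<open>If the new cells \<open>a\<close> and \<open>b\<close> differ, no minor of
  \<open>U\<close> occupies \<open>a\<close>, since it would be a minor of \<open>V\<close>;
  likewise with the roles exchanged. So \<open>mM_retains_cell\<close> must fail to apply to both
  cells, and \<open>rect_small\<close> contradicts the size of \<open>i\<close>.\<close>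

lemma one_step_reconstruction:
  assumes U: "tab (Suc i) U" and V: "tab (Suc i) V" and eq: "restr i U = restr i V"
    and mM: "mM k U = mM k V" and i: "k^2 + 2 * k \<le> i"
  shows "U = V"
proof -
  define W where "W = dom (restr i U)"
  obtain a where a: "dom U = insert a W" "a \<notin> W" "U = (restr i U)(a \<mapsto> Suc i)"
    using tab_extension[OF U] unfolding W_def by metis
  obtain b where b: "dom V = insert b W" "b \<notin> W" "V = (restr i V)(b \<mapsto> Suc i)"
    using tab_extension[OF V] eq unfolding W_def by metis
  have W: "finite W" "card W = i"
    using tab_restr[OF U, of i] tab_card[of i "restr i U"] unfolding W_def by (auto simp: tab_def)
  have dc: "downclosed (insert a W)" "downclosed (insert b W)"
    using U V a b by (auto simp: tab_def)
  have "a = b"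
  proof (rule ccontr)
    assume ne: "a \<noteq> b"
    have "\<not> card (rect a) + k \<le> Suc i"
      using mM_retains_cell[OF U, of a k] dom_mM[OF V, of _ k] a b ne mM by (metis insert_iff subsetD)
    moreover have "\<not> card (rect b) + k \<le> Suc i"
      using mM_retains_cell[OF V, of b k] dom_mM[OF U, of _ k] a b ne mM by (metis insert_iff subsetD)
    ultimately have big: "card W + 2 \<le> card (rect a) + k" "card W + 2 \<le> card (rect b) + k"
      using W by auto
    \<comment> \<open>Comparability would put one new cell into the order ideal obtained by adding
      the other.\<close>
    have "\<not> cell_le a b" "\<not> cell_le b a" using dc a(2) b(2) ne unfolding downclosed_def by blast+
    then have "fst a < fst b \<and> snd b < snd a \<or> fst b < fst a \<and> snd a < snd b"
      by (auto simp: cell_le_def)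
    then have "card W + 2 \<le> k^2 + 2 * k"
      using rect_small[OF W(1) dc(1) a(2) dc(2) b(2)] rect_small[OF W(1) dc(2) b(2) dc(1) a(2)] big
      by blast
    then show False using W i by simp
  qed
  then show ?thesis using a b eq by metis
qed

section \<open>Reconstruction level by level\<close>

lemma restr_restr: "i \<le> j \<Longrightarrow> restr i (restr j T) = restr i T"
  by (rule map_eqI) auto

lemma restr_all:
  assumes "tab n T"
  shows "restr n T = T"
proof (rule map_eqI)
  fix c x show "restr n T c = Some x \<longleftrightarrow> T c = Some x"
    using tab_range[OF assms, of c x] by auto
qed

theorem tab_reconstruction:
  assumes T: "tab n T" and S: "tab n S" and mM: "mM k S = mM k T"
    and bin: "2 * ((n - (k^2 + 2 * k)) choose k) > (n choose k)"
  shows "S = T"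
proof -
  let ?N = "k^2 + 2 * k"
  have base: "restr ?N S = restr ?N T" using restr_majority[OF T S mM bin] .
  have "restr i S = restr i T" if "i \<le> n" for i
    using that
  proof (induction i)
    case 0
    show ?case using base restr_restr[of 0 ?N S] restr_restr[of 0 ?N T] by simp
  next
    case (Suc i)
    show ?case
    proof (cases "Suc i \<le> ?N")
      case True
      then show ?thesis using base restr_restr[OF True, of S] restr_restr[OF True, of T] by simp
    next
      case False
      \<comment> \<open>The level at which minors are cut; as \<open>k \<le> ?N < Suc i\<close>, the
        subtraction is not truncated.\<close>
      define j where "j = Suc i - k"
      have j: "j + k = Suc i" using False by (simp add: j_def)
      have IH: "restr i S = restr i T" using Suc by simp
      have "restr l S = restr l T" if "l < j + k" for l
      proof -
        have "l \<le> i" using that j by simp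
        then show ?thesis using IH restr_restr[of l i S] restr_restr[of l i T] by simp
      qed
      \<comment> \<open>The cut minors of \<open>S\<close> and \<open>T\<close> coincide by
        \<open>mM\<close> and cancel in the exchange equation.\<close>
      then have "mM k (restr (Suc i) S) = mM k (restr (Suc i) T)"
        using mM_restr_exchange[OF S T, of j k] mM j Suc.prems by simp
      moreover have "restr i (restr (Suc i) S) = restr i (restr (Suc i) T)"
        using IH by (simp add: restr_restr)
      ultimately show ?thesis
        using one_step_reconstruction tab_restr[OF S Suc.prems] tab_restr[OF T Suc.prems] False
        by simp
    qed
  qed
  then show ?thesis using restr_all[OF T] restr_all[OF S] by (metis order_refl)
qed

section \<open>From partition shapes to order ideals\<close>

lemma YT_tab:
  assumes "T \<in> YT n"
  shows "tab n T"
proof -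
  obtain \<mu> where mu: "is_partition \<mu> n" "tableau_of_shape \<mu> T" and ran: "ran T = {1..n}"
    using assms by (auto simp: YT_def)
  have dom: "dom T = young_diagram \<mu>" and inj: "inj_on T (dom T)"
    and row: "\<And>i j j'. j < j' \<Longrightarrow> (i, j) \<in> dom T \<Longrightarrow> (i, j') \<in> dom T \<Longrightarrow> the (T (i, j)) < the (T (i, j'))"
    and col: "\<And>i i' j. i < i' \<Longrightarrow> (i, j) \<in> dom T \<Longrightarrow> (i', j) \<in> dom T \<Longrightarrow> the (T (i, j)) < the (T (i', j))"
    using mu(2) unfolding tableau_of_shape_def by auto
  have "finite (ran T)" using ran by simp
  moreover have "T ` dom T = Some ` ran T" by (force simp: ran_def)
  ultimately have fin: "finite (dom T)" using inj by (metis finite_imageD finite_imageI)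
  have dc: "downclosed (dom T)"
    unfolding downclosed_def dom
  proof (intro ballI allI impI)
    fix e d assume e: "e \<in> young_diagram \<mu>" and le: "cell_le d e"
    have "sorted_wrt (\<ge>) \<mu>" using mu(1) by (simp add: is_partition_def)
    then have "\<mu> ! fst e \<le> \<mu> ! fst d"
      using e le sorted_wrt_nth_less[of "(\<ge>)" \<mu> "fst d" "fst e"]
      by (cases "fst d = fst e") (auto simp: young_diagram_def cell_le_def)
    then show "d \<in> young_diagram \<mu>" using e le by (auto simp: young_diagram_def cell_le_def)
  qed
  have "increasing T"
    unfolding increasing_def
  proof (intro allI impI)
    fix d e x y
    assume T: "T d = Some x" "T e = Some y" and le: "cell_le d e" "d \<noteq> e"
    obtain i j i' j' where de: "d = (i, j)" "e = (i', j')" by (cases d; cases e)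
    \<comment> \<open>Compare through the corner in the row of \<open>d\<close> and the column of
      \<open>e\<close>, which is filled because the shape is an order ideal.\<close>
    have "cell_le (i, j') e" using le de by (auto simp: cell_le_def)
    then have "(i, j') \<in> dom T" using dc T unfolding downclosed_def by blast
    then obtain z where z: "T (i, j') = Some z" by auto
    have "x \<le> z" "j \<noteq> j' \<Longrightarrow> x < z"
      using row[of j j' i] z T le de by (cases "j = j'"; auto simp: cell_le_def dom_def)+
    moreover have "z \<le> y" "i \<noteq> i' \<Longrightarrow> z < y"
      using col[of i i' j'] z T le de by (cases "i = i'"; auto simp: cell_le_def dom_def)+
    ultimately show "x < y" using le de by fastforce
  qed
  then show ?thesis using fin inj dc ran by (simp add: tab_def)
qed

section \<open>The numerical thresholds\<close>

text \<open>A cross-multiplied bound on the quotient of the binomials: the factors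
  \<open>(n - i) / (n - N - i)\<close> grow with \<open>i\<close>, so each is at most the one for
  \<open>i = k - 1\<close>.\<close>

lemma binomial_ratio_le:
  assumes "N + k \<le> n"
  shows "real (n choose k) * real (n - N - k + 1) ^ k \<le> real ((n - N) choose k) * real (n - k + 1) ^ k"
proof -
  have "real (n - i) * real (n - N - k + 1) \<le> real (n - N - i) * real (n - k + 1)" if i: "i < k" for i
  proof -
    have "real (n - N - i) * real (n - k + 1) - real (n - i) * real (n - N - k + 1) = real N * (real k - 1 - real i)"
      using assms i by (simp add: of_nat_diff algebra_simps)
    moreover have "\<dots> \<ge> 0" using i by simp
    ultimately show ?thesis by linarith
  qed
  then have "(\<Prod>i<k. real (n - i) * real (n - N - k + 1)) \<le> (\<Prod>i<k. real (n - N - i) * real (n - k + 1))"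
    by (intro prod_mono) auto
  moreover have ch: "(\<Prod>i<k. real (m - i)) = fact k * real (m choose k)" if "k \<le> m" for m
  proof -
    have "(\<Prod>i<k. real (m - i)) = (\<Prod>i<k. real m - real i)"
      using that by (intro prod.cong) (auto simp: of_nat_diff)
    then show ?thesis
      by (simp add: binomial_gbinomial gbinomial_prod_rev lessThan_atLeast0)
  qed
  ultimately have "fact k * (real (n choose k) * real (n - N - k + 1) ^ k)
       \<le> fact k * (real ((n - N) choose k) * real (n - k + 1) ^ k)"
    using ch[of n] ch[of "n - N"] assms by (simp add: prod.distrib mult.assoc)
  then show ?thesis by simp
qed

text \<open>With \<open>D = n - N - k + 1\<close> the hypothesis says
  \<open>1 + N / D < 2 powr (1 / k)\<close>. Its \<open>k\<close>-th power bounds the quotient in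
  \<open>binomial_ratio_le\<close> by 2.\<close>

lemma binomial_half:
  fixes k N n :: nat
  assumes k: "k \<ge> 1"
    and n: "real n > real N + real k - 1 + real N / (2 powr (1 / real k) - 1)"
  shows "2 * ((n - N) choose k) > (n choose k)"
proof -
  have p: "2 powr (1 / real k) - 1 > 0" using k by simp
  \<comment> \<open>This quotient being nonnegative gives \<open>N + k \<le> n\<close>, so all
    natural subtractions below are exact.\<close>
  then have "real N / (2 powr (1 / real k) - 1) \<ge> 0" by simp
  then have "real n > real N + real k - 1" using n by linarith
  then have nk: "N + k \<le> n" by linarith
  define D where "D = real (n - N - k + 1)"
  have D: "D = real n - real N - real k + 1" using nk by (simp add: D_def of_nat_diff)
  have D0: "D > 0" using nk by (simp add: D_def)
  have "real N / (2 powr (1 / real k) - 1) < D" using n D by linarith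
  then have "real N < D * (2 powr (1 / real k) - 1)" using p by (simp add: pos_divide_less_eq)
  moreover have "real (n - k + 1) = D + real N" using nk D by (simp add: of_nat_diff)
  ultimately have "real (n - k + 1) < D * 2 powr (1 / real k)" by (simp add: algebra_simps)
  then have "real (n - k + 1) ^ k < (D * 2 powr (1 / real k)) ^ k"
    using k by (intro power_strict_mono) auto
  also have "\<dots> = 2 * D ^ k"
    using k by (simp add: power_mult_distrib powr_realpow[symmetric] powr_powr)
  finally have lt: "real (n - k + 1) ^ k < 2 * D ^ k" .
  have "(n - N) choose k > 0" using nk by simp
  then have "real ((n - N) choose k) * real (n - k + 1) ^ k < real ((n - N) choose k) * (2 * D ^ k)"
    using lt by simp
  then have "real (n choose k) * D ^ k < real ((n - N) choose k) * (2 * D ^ k)"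
    using binomial_ratio_le[OF nk] unfolding D_def by linarith
  then have "real (n choose k) * D ^ k < (2 * real ((n - N) choose k)) * D ^ k" by simp
  then have "real (n choose k) < 2 * real ((n - N) choose k)" using D0 by simp
  then show ?thesis by linarith
qed

text \<open>Equivalent to bounding \<open>exp x\<close> from below by its \<open>(2,2)\<close> Pade approximant
  \<open>(12 + 6x + x\<^sup>2) / (12 - 6x + x\<^sup>2)\<close>.\<close>

lemma inverse_exp_minus_one_le:
  fixes x :: real
  assumes "0 < x" "x \<le> 1"
  shows "1 / (exp x - 1) \<le> 1 / x - 1 / 2 + x / 12"
proof -
  have "(\<Sum>i<6. x ^ i /\<^sub>R fact i) \<le> exp x"
    unfolding exp_def using assms by (intro sum_le_suminf summable_exp_generic) auto
  then have e: "120 + 120 * x + 60 * x^2 + 20 * x^3 + 5 * x^4 + x^5 \<le> 120 * exp x" (is "?e \<le> _")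
    by (simp add: lessThan_nat_numeral fact_numeral)
  have "x^2 \<ge> 0" by simp
  then have q: "12 - 6 * x + x^2 > 0" "2 - x + x^2 \<ge> 0" using assms by linarith+
  have "120 * (12 + 6 * x + x^2) \<le> 120 * (12 + 6 * x + x^2) + x^5 * (2 - x + x^2)"
    using assms q by simp
  \<comment> \<open>The product with the Taylor polynomial of degree 5, scaled by
    \<open>5! = 120\<close>, reproduces the numerator up to a remainder that is nonnegative for
    \<open>x > 0\<close>.\<close>
  also have "\<dots> = (12 - 6 * x + x^2) * ?e" by algebra
  also have "\<dots> \<le> (12 - 6 * x + x^2) * (120 * exp x)" using e q by (intro mult_left_mono) auto
  finally have "12 + 6 * x + x^2 \<le> (12 - 6 * x + x^2) * exp x" by simp
  then have "12 * x \<le> (exp x - 1) * (12 - 6 * x + x^2)" by (simp add: algebra_simps)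
  moreover have "exp x - 1 > 0" using assms by simp
  ultimately have "1 / (exp x - 1) \<le> (12 - 6 * x + x^2) / (12 * x)"
    using assms by (simp add: divide_simps mult.commute)
  also have "\<dots> = 1 / x - 1 / 2 + x / 12" using assms by (simp add: field_simps power2_eq_square)
  finally show ?thesis .
qed

text \<open>Put \<open>x = ln 2 / k\<close>, so that \<open>2 powr (1 / k) = exp x\<close>.
  Multiplying the bound on \<open>1 / (exp x - 1)\<close> by \<open>k^2 + 2 * k\<close> yields the
  right side term by term; the \<open>- 1 / 2\<close> turns \<open>k^2 + 3 * k\<close> into
  \<open>k^2 / 2 + 2 * k\<close>.\<close>

lemma threshold_le:
  assumes "k \<ge> (1::nat)"
  shows "real k ^ 2 + 3 * real k - 1 + (real k ^ 2 + 2 * real k) / (2 powr (1 / real k) - 1)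
     \<le> (real k ^ 3 + 2 * real k ^ 2) / ln 2 + real k ^ 2 / 2 + 2 * real k - 1 + ln 2 / 12 * (real k + 2)"
proof -
  define x where "x = ln 2 / real k"
  have k: "real k > 0" "real k \<ge> 1" using assms by auto
  have l: "ln 2 > (0::real)" "ln 2 \<le> (1::real)" using ln_le_minus_one[of "2::real"] by auto
  have x: "0 < x" "x \<le> 1" using k l by (auto simp: x_def divide_simps)
  have "2 powr (1 / real k) = exp x" by (simp add: powr_def x_def)
  then have "(real k ^ 2 + 2 * real k) / (2 powr (1 / real k) - 1)
      = (real k ^ 2 + 2 * real k) * (1 / (exp x - 1))" by simp
  also have "\<dots> \<le> (real k ^ 2 + 2 * real k) * (1 / x - 1 / 2 + x / 12)"
    using inverse_exp_minus_one_le[OF x] by (intro mult_left_mono) auto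
  also have "\<dots> = (real k ^ 3 + 2 * real k ^ 2) / ln 2 - real k ^ 2 / 2 - real k + ln 2 / 12 * (real k + 2)"
    using k l by (simp add: x_def field_simps power2_eq_square power3_eq_cube)
  finally show ?thesis by simp
qed

theorem theorem4p1:
  fixes n k :: nat and T :: filling
  assumes "n \<ge> 1" and "k \<ge> 1" and "T \<in> YT n"
  shows "(2 * ((n - (k^2 + 2 * k)) choose k) > (n choose k)
            \<longrightarrow> (\<forall>S \<in> YT n. mM k S = mM k T \<longrightarrow> S = T))
       \<and> (real n > real k ^ 2 + 3 * real k - 1
                     + (real k ^ 2 + 2 * real k) / (2 powr (1 / real k) - 1)
            \<longrightarrow> 2 * ((n - (k^2 + 2 * k)) choose k) > (n choose k))
       \<and> (real n > (real k ^ 3 + 2 * real k ^ 2) / ln 2 + real k ^ 2 / 2 + 2 * real k - 1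
                     + ln 2 / 12 * (real k + 2)
            \<longrightarrow> real n > real k ^ 2 + 3 * real k - 1
                           + (real k ^ 2 + 2 * real k) / (2 powr (1 / real k) - 1)
              \<and> 2 * ((n - (k^2 + 2 * k)) choose k) > (n choose k))"
proof -
  let ?P = "real n > real k ^ 2 + 3 * real k - 1
              + (real k ^ 2 + 2 * real k) / (2 powr (1 / real k) - 1)"
  let ?Q = "2 * ((n - (k^2 + 2 * k)) choose k) > (n choose k)"
  have "?P \<Longrightarrow> ?Q" using binomial_half[OF assms(2), of "k^2 + 2 * k" n] by simp
  moreover have "?Q \<Longrightarrow> \<forall>S\<in>YT n. mM k S = mM k T \<longrightarrow> S = T"
    using tab_reconstruction YT_tab assms(3) by blast
  ultimately show ?thesis using threshold_le[OF assms(2)] by (meson order_le_less_trans)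
qed

end
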